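(* Let $C^{ijkl}$ be an elasticity tensor in three dimensions, and let $A^{ijkl}:=C^{ijkl}-C^{(ijkl)}$, $N^{ijkl}:=C^{i[jk]l}$ and $\Delta_{mn}:=\frac14\epsilon_{mik}\epsilon_{njl}A^{ijkl}$. Then the following conditions are equivalent: (i) $A^{ijkl}=0$ for all indices; (ii) $\Delta_{mn}=0$ for all indices; (iii) $N^{ijkl}=0$ for all indices; (iv) the Cauchy relations $C^{ijkl}=C^{ikjl}$ hold for all indices; (v) $C^{1122}=C^{1212}$, $C^{1133}=C^{3131}$, $C^{1123}=C^{3112}$, $C^{2233}=C^{2323}$, $C^{2231}=C^{2312}$, $C^{3312}=C^{2331}$.
   Context: Indices run over $1,2,3$; summation over repeated indices. An elasticity tensor is a real fourth-rank tensor $C^{ijkl}$ on $\mathbb R^3$ with $C^{ijkl}=C^{jikl}$, $C^{ijkl}=C^{ijlk}$ (minor symmetries) and $C^{ijkl}=C^{klij}$ (major symmetry). $C^{(ijkl)}$ is $\frac1{4!}$ times the sum over all permutations of the indices, and $C^{i[jk]l}=\frac12(C^{ijkl}-C^{ikjl})$. $\epsilon_{ijk}$ is the Levi-Civita symbol. *)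

theory Defs
  imports "HOL-Analysis.Analysis"
begin

text \<open>
  A fourth-rank tensor on real three-space is given by its components with respect to the
  standard basis, with indices in the three-element type \<open>3\<close>.  In this type the numerals
  \<open>1\<close>, \<open>2\<close>, \<open>3\<close> are the three distinct elements (with \<open>3 = 0\<close>).
\<close>

type_synonym tensor4 = "3 \<Rightarrow> 3 \<Rightarrow> 3 \<Rightarrow> 3 \<Rightarrow> real"

definition elasticity_tensor :: "tensor4 \<Rightarrow> bool" where
  "elasticity_tensor C \<longleftrightarrow>
     (\<forall>i j k l. C i j k l = C j i k l) \<and>
     (\<forall>i j k l. C i j k l = C i j l k) \<and>
     (\<forall>i j k l. C i j k l = C k l i j)"

text \<open>
  Total symmetrization: the average over all permutations of the four index \<^emph>\<open>positions\<close>,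
  so that repeated index values are counted with multiplicity.
\<close>

definition total_sym :: "tensor4 \<Rightarrow> tensor4" where
  "total_sym C i j k l =
     (\<Sum>p | p permutes {..<4}.
        C ([i, j, k, l] ! p 0) ([i, j, k, l] ! p 1) ([i, j, k, l] ! p 2) ([i, j, k, l] ! p 3))
     / fact 4"

definition tensor_A :: "tensor4 \<Rightarrow> tensor4" where
  "tensor_A C i j k l = C i j k l - total_sym C i j k l"

definition tensor_N :: "tensor4 \<Rightarrow> tensor4" where
  "tensor_N C i j k l = (C i j k l - C i k j l) / 2"

definition levi_civita :: "3 \<Rightarrow> 3 \<Rightarrow> 3 \<Rightarrow> real" where
  "levi_civita i j k =
     (if (i, j, k) \<in> {(1, 2, 3), (2, 3, 1), (3, 1, 2)} then 1
      else if (i, j, k) \<in> {(1, 3, 2), (2, 1, 3), (3, 2, 1)} then - 1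
      else 0)"

definition tensor_Delta :: "tensor4 \<Rightarrow> 3 \<Rightarrow> 3 \<Rightarrow> real" where
  "tensor_Delta C m n =
     1 / 4 * (\<Sum>i\<in>UNIV. \<Sum>j\<in>UNIV. \<Sum>k\<in>UNIV. \<Sum>l\<in>UNIV.
       levi_civita m i k * levi_civita n j l * tensor_A C i j k l)"

end

theory Submission
  imports Defs
begin

text \<open>
  By the minor and major symmetries the 24 terms of the symmetrization collapse to the three
  pairings of the indices, so \<open>A\<close> is a combination of Cauchy differences; on the other hand the
  six independent components of \<open>\<Delta>\<close> are nonzero multiples of the six differences in (v).
\<close>

lemma elasticity_tensor_symmetries:
  assumes "elasticity_tensor C"
  shows "C i j k l = C j i k l" and "C i j k l = C i j l k" and "C i j k l = C k l i j"
  using assms unfolding elasticity_tensor_def by blast+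

lemma total_sym_elasticity:
  assumes "elasticity_tensor C"
  shows "total_sym C i j k l = (C i j k l + C i k j l + C i l j k) / 3"
proof -
  note sym = elasticity_tensor_symmetries[OF assms]
  \<comment> \<open>Inserting the positions one at a time builds the 24 permutations out of
    transpositions.\<close>
  have "{..<4::nat} = {0, 1, 2, 3}"
    by auto
  \<comment> \<open>Eight of the 24 permutations preserve a given pairing of the four positions,
    hence the weights 8.\<close>
  then have "total_sym C i j k l = (8 * C i j k l + 8 * C i k j l + 8 * C i l j k) / 24"
    unfolding total_sym_def
    by (simp add: sum_over_permutations_insert transpose_def sym fact_numeral)
  then show ?thesis
    by simp
qed

text \<open>The totally symmetric part of \<open>C\<close> cancels against \<epsilon>, which is
  antisymmetric in the contracted pairs, so only Cauchy differences of \<open>C\<close> survive. The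
  order follows (v).\<close>

lemma tensor_Delta_elasticity:
  assumes "elasticity_tensor C"
  shows "tensor_Delta C 3 3 = (C 1 1 2 2 - C 1 2 1 2) / 2"
    and "tensor_Delta C 2 2 = (C 1 1 3 3 - C 3 1 3 1) / 2"
    and "tensor_Delta C 2 3 = (C 3 1 1 2 - C 1 1 2 3) / 2"
    and "tensor_Delta C 1 1 = (C 2 2 3 3 - C 2 3 2 3) / 2"
    and "tensor_Delta C 1 3 = (C 2 3 1 2 - C 2 2 3 1) / 2"
    and "tensor_Delta C 1 2 = (C 2 3 3 1 - C 3 3 1 2) / 2"
  by (simp_all add: tensor_Delta_def sum_3 levi_civita_def tensor_A_def
      total_sym_elasticity[OF assms] elasticity_tensor_symmetries[OF assms] field_simps)

theorem mainTheorem12: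
  fixes C :: tensor4
  assumes "elasticity_tensor C"
  shows "((\<forall>i j k l. tensor_A C i j k l = 0) \<longleftrightarrow> (\<forall>m n. tensor_Delta C m n = 0)) \<and>
         ((\<forall>m n. tensor_Delta C m n = 0) \<longleftrightarrow> (\<forall>i j k l. tensor_N C i j k l = 0)) \<and>
         ((\<forall>i j k l. tensor_N C i j k l = 0) \<longleftrightarrow> (\<forall>i j k l. C i j k l = C i k j l)) \<and>
         ((\<forall>i j k l. C i j k l = C i k j l) \<longleftrightarrow>
           (C 1 1 2 2 = C 1 2 1 2 \<and> C 1 1 3 3 = C 3 1 3 1 \<and> C 1 1 2 3 = C 3 1 1 2 \<and>
            C 2 2 3 3 = C 2 3 2 3 \<and> C 2 2 3 1 = C 2 3 1 2 \<and> C 3 3 1 2 = C 2 3 3 1))"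
    (is "(?A \<longleftrightarrow> ?D) \<and> (_ \<longleftrightarrow> ?N) \<and> (_ \<longleftrightarrow> ?cauchy) \<and> (_ \<longleftrightarrow> ?six)")
proof -
  note sym = elasticity_tensor_symmetries[OF assms]
  have "?A \<Longrightarrow> ?D"
    by (simp add: tensor_Delta_def)
  moreover have "?D \<Longrightarrow> ?six"
    using tensor_Delta_elasticity[OF assms] by simp
  \<comment> \<open>Of the 81 instances, those with j = k or i = l hold by symmetry alone; each of
    the others reduces to one of the six equations.\<close>
  moreover have "?six \<Longrightarrow> ?cauchy"
    unfolding forall_3 by (simp add: sym)
  moreover have "?cauchy \<Longrightarrow> ?A"
  proof (intro allI)
    fix i j k l
    assume cauchy: ?cauchy
    have "C i k j l = C i j k l"
      using cauchy by simp
    \<comment> \<open>A Cauchy swap gives \<open>C i j l k\<close>, then a minor symmetry gives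
      \<open>C i j k l\<close>. Thus all three pairings agree and their average is
      \<open>C i j k l\<close>.\<close>
    moreover have "C i l j k = C i j k l"
      using cauchy sym by metis
    ultimately show "tensor_A C i j k l = 0"
      by (simp add: tensor_A_def total_sym_elasticity[OF assms])
  qed
  moreover have "?N \<longleftrightarrow> ?cauchy"
    by (simp add: tensor_N_def)
  ultimately show ?thesis
    by argo
qed

end
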